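(* Let $f:\mathbb{R}^2\to\mathbb{R}^2$ be defined by $f(x_1,x_2)=\left(\frac{x_1^2-x_2^2}{\sqrt{x_1^2+x_2^2}},\frac{2x_1x_2}{\sqrt{x_1^2+x_2^2}}\right)$ for $(x_1,x_2)\in\mathbb{R}^2\setminus\{\theta\}$ and $f(\theta)=\theta$. Then $$\hat{\alpha}(f,\bar z,f(\bar z))=1\quad\text{for any }\bar z\in\mathbb{R}^2.$$
   Context: $\theta$ denotes the origin; $\mathbb{R}^2$ has the Euclidean norm and inner product, and $\mathbb{B}(p,\eta)$ is the closed ball of center $p$ and radius $\eta$. Mordukhovich derivative: for $z,y\in\mathbb{R}^2$, $\widehat{D}^*f(z)(y)=\Big\{x\in\mathbb{R}^2:\limsup_{u\to z}\frac{\langle x,u-z\rangle-\langle y,f(u)-f(z)\rangle}{\|u-z\|+\|f(u)-f(z)\|}\le 0\Big\}$ ($f$ is continuous); this set may be empty. Covering constant: for $\bar w=f(\bar z)$, $$\hat{\alpha}(f,\bar z,\bar w)=\sup_{\eta>0}\inf\{\|x\|:x\in\widehat{D}^*f(z)(y),\ z\in\mathbb{B}(\bar z,\eta),\ f(z)\in\mathbb{B}(\bar w,\eta),\ \|y\|=1\}.$$ *)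

theory Defs
  imports "HOL-Analysis.Analysis"
begin

(* The dual space is identified with the space itself through the inner product.
   "at z" is the punctured neighbourhood filter, and the limit superior is taken in ereal,
   so that it exists without boundedness assumptions on the quotient. Only u \<rightarrow> z is
   required (not also f u \<rightarrow> f z): the notion is meant for continuous f. *)
definition mordukhovich_derivative ::
  "('a::euclidean_space \<Rightarrow> 'b::euclidean_space) \<Rightarrow> 'a \<Rightarrow> 'b \<Rightarrow> 'a set" where
  "mordukhovich_derivative f z y =
     {x. Limsup (at z) (\<lambda>u. ereal ((x \<bullet> (u - z) - y \<bullet> (f u - f z)) /
                                   (norm (u - z) + norm (f u - f z)))) \<le> 0}"

(* Values in ereal: the infimum of the empty set is \<infinity>, so pairs (z, y) with empty
   derivative do not contribute, and neither infimum nor supremum takes a junk value. *)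
definition covering_constant ::
  "('a::euclidean_space \<Rightarrow> 'b::euclidean_space) \<Rightarrow> 'a \<Rightarrow> 'b \<Rightarrow> ereal" where
  "covering_constant f zbar wbar =
     (SUP \<eta>\<in>{0::real<..}.
        Inf {ereal (norm x) | x y z.
               x \<in> mordukhovich_derivative f z y \<and> z \<in> cball zbar \<eta> \<and>
               f z \<in> cball wbar \<eta> \<and> norm y = 1})"

definition angle_doubling :: "real^2 \<Rightarrow> real^2" where
  "angle_doubling x =
     (if x = 0 then 0
      else vector [((x$1)\<^sup>2 - (x$2)\<^sup>2) / sqrt ((x$1)\<^sup>2 + (x$2)\<^sup>2),
                   (2 * x$1 * x$2) / sqrt ((x$1)\<^sup>2 + (x$2)\<^sup>2)])"

end

(* The map f doubles angles and preserves norms, so u \<bullet> v - f u \<bullet> f v is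
   |u| |v| (cos \<phi> - cos 2 \<phi>) with \<phi> the angle between u and v. This is nonnegative for
   \<phi> \<le> pi/2, and either u or -u makes such an angle with v. Hence every w has a preimage u
   with |u - z| \<le> |w - f z|, and moving the image from f z in the direction -y shows
   |x| \<ge> |y| for each x in the derivative at z. Conversely u \<bullet> v - f u \<bullet> f v is
   O(|u - v|^2), so z/|z| belongs to the derivative at z in the direction f z/|z|. *)
theory Submission imports Defs begin

text \<open>The denominator is positive for \<open>u \<noteq> z\<close>, so multiplying by it turns
  the bound on the limit superior into real inequalities with neither quotients nor
  \<open>ereal\<close>.\<close>

lemma mem_mordukhovich_derivative_iff:
  "x \<in> mordukhovich_derivative f z y \<longleftrightarrow>
     (\<forall>e>0. \<forall>\<^sub>F u in at z. x \<bullet> (u - z) - y \<bullet> (f u - f z)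
        < e * (norm (u - z) + norm (f u - f z)))" (is "?L \<longleftrightarrow> ?R")
proof -
  define q where "q u = (x \<bullet> (u - z) - y \<bullet> (f u - f z)) / (norm (u - z) + norm (f u - f z))" for u
  have eq: "(\<forall>\<^sub>F u in at z. q u < e) \<longleftrightarrow>
      (\<forall>\<^sub>F u in at z. x \<bullet> (u - z) - y \<bullet> (f u - f z) < e * (norm (u - z) + norm (f u - f z)))" for e
  proof (rule eventually_cong[OF eventually_neq_at_within[of z z UNIV]])
    fix u assume "u \<noteq> z"
    then have "norm (u - z) + norm (f u - f z) > 0"
      by (simp add: add_pos_nonneg)
    then show "q u < e \<longleftrightarrow>
        x \<bullet> (u - z) - y \<bullet> (f u - f z) < e * (norm (u - z) + norm (f u - f z))"
      by (simp add: q_def pos_divide_less_eq)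
  qed
  have "?L \<longleftrightarrow> (\<forall>E>0. \<forall>\<^sub>F u in at z. ereal (q u) < E)"
    by (simp add: mordukhovich_derivative_def q_def Limsup_le_iff)
  also have "\<dots> \<longleftrightarrow> (\<forall>e>0. \<forall>\<^sub>F u in at z. q u < e)"
  proof (intro iffI allI impI)
    fix e :: real assume "\<forall>E>0. \<forall>\<^sub>F u in at z. ereal (q u) < E" "e > 0"
    then have "\<forall>\<^sub>F u in at z. ereal (q u) < ereal e" by (simp del: less_ereal.simps)
    then show "\<forall>\<^sub>F u in at z. q u < e" by simp
  next
    fix E :: ereal assume *: "\<forall>e>0. \<forall>\<^sub>F u in at z. q u < e" and "E > 0"
    then show "\<forall>\<^sub>F u in at z. ereal (q u) < E" by (cases E) auto
  qed
  finally show ?thesis by (simp add: eq)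
qed

text \<open>Let \<open>u\<close> be the preimage of \<open>f z - t *\<^sub>R y\<close> given by
  \<open>cover\<close>. By Cauchy-Schwarz the numerator is at least
  \<open>t * norm y * (norm y - norm x)\<close>, and the denominator is at most
  \<open>2 * t * norm y\<close>. If \<open>norm x < norm y\<close>, the quotient therefore stays
  above the positive number \<open>e\<close>, half the gap between the norms, for arbitrarily small
  \<open>t\<close>.\<close>

lemma norm_le_mordukhovich_derivative:
  assumes cover: "\<And>w. \<exists>u. f u = w \<and> norm (u - z) \<le> norm (w - f z)"
    and x: "x \<in> mordukhovich_derivative f z y"
  shows "norm y \<le> norm x"
proof (rule ccontr)
  assume "\<not> norm y \<le> norm x"
  then have lt: "norm x < norm y" by simp
  then have y: "norm y > 0" using norm_ge_zero[of x] by linarith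
  define e where "e = (norm y - norm x) / 2"
  have e: "e > 0" using lt by (simp add: e_def)
  obtain d where d: "d > 0" and
    D: "\<And>u. u \<noteq> z \<Longrightarrow> dist u z < d \<Longrightarrow>
      x \<bullet> (u - z) - y \<bullet> (f u - f z) < e * (norm (u - z) + norm (f u - f z))"
    using x e unfolding mem_mordukhovich_derivative_iff eventually_at by blast
  \<comment> \<open>This makes \<open>t * norm y\<close> equal to \<open>d / 2\<close>, which keeps
    the preimage within distance \<open>d\<close> of \<open>z\<close>.\<close>
  define t where "t = d / (2 * norm y)"
  have t: "t > 0" "t * norm y < d" using d y by (auto simp: t_def)
  obtain u where u: "f u = f z - t *\<^sub>R y" "norm (u - z) \<le> t * norm y"
    using cover[of "f z - t *\<^sub>R y"] t by auto
  have "u \<noteq> z" using u(1) t y by auto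
  moreover have "dist u z < d" using u(2) t by (simp add: dist_norm)
  ultimately have "x \<bullet> (u - z) + t * (norm y)\<^sup>2 < e * (norm (u - z) + t * norm y)"
    using D[of u] u(1) t by (simp add: power2_norm_eq_inner)
  also have "\<dots> \<le> e * (t * norm y + t * norm y)"
    using u(2) e by (intro mult_left_mono) auto
  finally have 1: "x \<bullet> (u - z) + t * (norm y)\<^sup>2 < 2 * e * (t * norm y)" by simp
  have "\<bar>x \<bullet> (u - z)\<bar> \<le> norm x * (t * norm y)"
    using Cauchy_Schwarz_ineq2[of x "u - z"] mult_left_mono[OF u(2), of "norm x"] by simp
  then have "t * (norm y)\<^sup>2 < (2 * e + norm x) * (t * norm y)"
    using 1 by (simp add: algebra_simps)
  moreover have "2 * e + norm x = norm y" unfolding e_def by argo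
  ultimately show False by (simp add: power2_eq_square mult_ac)
qed

lemma inner_vec2: "(u::real^2) \<bullet> v = u$1 * v$1 + u$2 * v$2"
  by (simp add: inner_vec_def sum_2)

lemma norm_vec2: "norm (u::real^2) = sqrt ((u$1)\<^sup>2 + (u$2)\<^sup>2)"
  by (simp add: norm_eq_sqrt_inner inner_vec2 power2_eq_square)

(* The factor |u| absorbs the case distinction at the origin. *)
lemma norm_mult_angle_doubling:
  "norm u * angle_doubling u $ 1 = (u$1)\<^sup>2 - (u$2)\<^sup>2"
  "norm u * angle_doubling u $ 2 = 2 * u$1 * u$2"
proof -
  have "u \<noteq> 0 \<Longrightarrow> sqrt ((u$1)\<^sup>2 + (u$2)\<^sup>2) \<noteq> 0" by (metis norm_vec2 norm_eq_zero)
  then show "norm u * angle_doubling u $ 1 = (u$1)\<^sup>2 - (u$2)\<^sup>2"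
    "norm u * angle_doubling u $ 2 = 2 * u$1 * u$2"
    by (auto simp: angle_doubling_def norm_vec2)
qed

lemma angle_doubling_0 [simp]: "angle_doubling 0 = 0"
  by (simp add: angle_doubling_def)

lemma angle_doubling_minus [simp]: "angle_doubling (- u) = angle_doubling u"
  by (simp add: angle_doubling_def)

text \<open>This is cos 2\<phi> = 2 cos\<phi> cos\<phi> - 1, scaled by the square of
  \<open>norm u * norm v\<close>; in this form it needs no angle and survives zero vectors.\<close>

lemma inner_angle_doubling:
  "norm u * norm v * (angle_doubling u \<bullet> angle_doubling v) = 2 * (u \<bullet> v)\<^sup>2 - (norm u * norm v)\<^sup>2"
proof -
  have "norm u * norm v * (angle_doubling u \<bullet> angle_doubling v)
      = (norm u * angle_doubling u $ 1) * (norm v * angle_doubling v $ 1)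
        + (norm u * angle_doubling u $ 2) * (norm v * angle_doubling v $ 2)"
    by (simp add: inner_vec2 algebra_simps)
  also have "\<dots> = 2 * (u \<bullet> v)\<^sup>2 - (norm u)\<^sup>2 * (norm v)\<^sup>2"
    unfolding norm_mult_angle_doubling power2_norm_eq_inner inner_vec2 by algebra
  finally show ?thesis by (simp add: power_mult_distrib)
qed

lemma norm_angle_doubling [simp]: "norm (angle_doubling u) = norm u"
proof (cases "u = 0")
  case False
  have "(norm u)\<^sup>2 * (norm (angle_doubling u))\<^sup>2 = (norm u)\<^sup>2 * (norm u)\<^sup>2"
    using inner_angle_doubling[of u u] unfolding power2_norm_eq_inner[symmetric] by (simp add: power2_eq_square)
  then have "(norm (angle_doubling u))\<^sup>2 = (norm u)\<^sup>2"
    unfolding mult_cancel_left using False by simp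
  then show ?thesis by simp
qed simp

text \<open>The factorization cos \<phi> - cos 2\<phi> = (1 - cos \<phi>)(1 + 2 cos \<phi>). The
  first factor is nonnegative by Cauchy-Schwarz, so the second decides the sign.\<close>

lemma inner_angle_doubling_diff:
  "norm u * norm v * (u \<bullet> v - angle_doubling u \<bullet> angle_doubling v)
     = (norm u * norm v - u \<bullet> v) * (norm u * norm v + 2 * (u \<bullet> v))"
  using inner_angle_doubling[of u v] by (simp add: power2_eq_square algebra_simps)

lemma norm_diff_sq:
  fixes u v :: "'a::real_inner"
  shows "(norm (u - v))\<^sup>2 = (norm u)\<^sup>2 + (norm v)\<^sup>2 - 2 * (u \<bullet> v)"
  unfolding power2_norm_eq_inner by (simp add: algebra_simps inner_commute)

text \<open>Since norms are preserved, comparing the two squared distances amounts to comparing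
  inner products, and for \<open>u \<bullet> v \<ge> 0\<close> both factors of
  \<open>inner_angle_doubling_diff\<close> are nonnegative.\<close>

lemma angle_doubling_expanding:
  assumes "u \<bullet> v \<ge> 0"
  shows "norm (u - v) \<le> norm (angle_doubling u - angle_doubling v)"
proof -
  have "u \<bullet> v \<ge> angle_doubling u \<bullet> angle_doubling v"
  proof (cases "u = 0 \<or> v = 0")
    case False
    have "norm u * norm v * (u \<bullet> v - angle_doubling u \<bullet> angle_doubling v) \<ge> 0"
      unfolding inner_angle_doubling_diff
      using assms norm_cauchy_schwarz[of u v] by simp
    moreover have "norm u * norm v > 0" using False by simp
    ultimately show ?thesis unfolding zero_le_mult_iff by auto
  qed auto
  then have "(norm (u - v))\<^sup>2 \<le> (norm (angle_doubling u - angle_doubling v))\<^sup>2"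
    by (simp add: norm_diff_sq)
  then show ?thesis by simp
qed

text \<open>The constant is 3 times 1/2: the second factor of
  \<open>inner_angle_doubling_diff\<close> is at most \<open>3 * p\<close>, and
  \<open>p - u \<bullet> v\<close> is at most half the squared distance because \<open>2 * p\<close>
  is bounded by the sum of the squared norms.\<close>

lemma inner_diff_angle_doubling_le:
  "u \<bullet> v - angle_doubling u \<bullet> angle_doubling v \<le> 3/2 * (norm (u - v))\<^sup>2"
proof (cases "u = 0 \<or> v = 0")
  case False
  define p where "p = norm u * norm v"
  have p: "p > 0" using False by (simp add: p_def)
  have P: "u \<bullet> v \<le> p" using norm_cauchy_schwarz[of u v] by (simp add: p_def)
  have "p * (u \<bullet> v - angle_doubling u \<bullet> angle_doubling v) = (p - u \<bullet> v) * (p + 2 * (u \<bullet> v))"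
    using inner_angle_doubling_diff[of u v] by (simp add: p_def)
  also have "\<dots> \<le> (p - u \<bullet> v) * (3 * p)"
    using P by (intro mult_left_mono) auto
  also have "\<dots> = p * (3 * (p - u \<bullet> v))" by simp
  finally have "u \<bullet> v - angle_doubling u \<bullet> angle_doubling v \<le> 3 * (p - u \<bullet> v)"
    using p by (simp only: mult_le_cancel_left_pos)
  moreover have "2 * (p - u \<bullet> v) \<le> (norm (u - v))\<^sup>2"
    using sum_squares_bound[of "norm u" "norm v"] by (simp add: norm_diff_sq p_def)
  ultimately show ?thesis by simp
qed auto

lemma angle_doubling_surj: "\<exists>u. angle_doubling u = w"
proof (cases "w = 0")
  case False
  \<comment> \<open>In complex notation the map sends c to the square of c divided by |c|. As |c|
    must equal |w|, the equation to solve is that the square of c is |w| w.\<close>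
  define c where "c = csqrt (norm w * Complex (w$1) (w$2))"
  define u :: "real^2" where "u = vector [Re c, Im c]"
  have cw: "c\<^sup>2 = Complex (norm w * w$1) (norm w * w$2)"
    by (simp add: c_def complex_eq_iff)
  have 1: "(u$1)\<^sup>2 - (u$2)\<^sup>2 = norm w * w$1" "2 * u$1 * u$2 = norm w * w$2"
    using arg_cong[OF cw, of Re] arg_cong[OF cw, of Im]
    by (auto simp: u_def power2_eq_square mult_ac)
  have "(cmod c)\<^sup>2 = cmod (norm w * Complex (w$1) (w$2))"
    by (simp add: c_def flip: norm_power)
  also have "\<dots> = (norm w)\<^sup>2"
    unfolding norm_mult by (simp add: cmod_def norm_vec2 power2_eq_square)
  finally have "cmod c = norm w" by simp
  then have "norm u = norm w"
    by (simp add: norm_vec2 u_def cmod_def)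
  then have "norm w * angle_doubling u $ i = norm w * w $ i" for i
    using norm_mult_angle_doubling[of u] 1 exhaust_2[of i] by auto
  then have "angle_doubling u = w" using False by (auto simp only: vec_eq_iff mult_cancel_left norm_eq_zero)
  then show ?thesis by blast
qed (use angle_doubling_0 in blast)

text \<open>Both \<open>v\<close> and \<open>- v\<close> have image \<open>w\<close>, so the sign
  can be chosen to suit \<open>angle_doubling_expanding\<close>.\<close>

lemma angle_doubling_covering:
  "\<exists>u. angle_doubling u = w \<and> norm (u - z) \<le> norm (w - angle_doubling z)"
proof -
  obtain v where v: "angle_doubling v = w" using angle_doubling_surj by blast
  define u where "u = (if v \<bullet> z \<ge> 0 then v else - v)"
  have "angle_doubling u = w" "u \<bullet> z \<ge> 0" using v by (auto simp: u_def)
  then show ?thesis using angle_doubling_expanding[of u z] by blast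
qed

lemma sgn_mem_mordukhovich_derivative_angle_doubling:
  assumes "z \<noteq> 0"
  shows "z /\<^sub>R norm z \<in> mordukhovich_derivative angle_doubling z (angle_doubling z /\<^sub>R norm z)"
  unfolding mem_mordukhovich_derivative_iff
proof (intro allI impI)
  fix e :: real assume e: "e > 0"
  define r where "r = norm z"
  have r: "r > 0" using assms by (simp add: r_def)
  \<comment> \<open>Within this radius the quadratic bound \<open>3/2 * n * n\<close> falls below
    \<open>r * (e * n)\<close>, where \<open>n\<close> is the distance from \<open>u\<close> to
    \<open>z\<close>.\<close>
  have "\<forall>\<^sub>F u in at z. norm (u - z) < e * r / 2 \<and> u \<noteq> z"
    unfolding eventually_at using e r by (intro exI[of _ "e * r / 2"]) (auto simp: dist_norm)
  then show "\<forall>\<^sub>F u in at z. (z /\<^sub>R norm z) \<bullet> (u - z)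
      - (angle_doubling z /\<^sub>R norm z) \<bullet> (angle_doubling u - angle_doubling z)
      < e * (norm (u - z) + norm (angle_doubling u - angle_doubling z))"
  proof (rule eventually_mono)
    fix u assume u: "norm (u - z) < e * r / 2 \<and> u \<noteq> z"
    define n where "n = norm (u - z)"
    have n: "0 < n" "n < e * r / 2" using u by (auto simp: n_def)
    \<comment> \<open>This cancels the constant terms of the numerator, leaving the difference of
      inner products bounded by \<open>inner_diff_angle_doubling_le\<close>.\<close>
    have zz: "angle_doubling z \<bullet> angle_doubling z = z \<bullet> z"
      by (simp add: power2_norm_eq_inner[symmetric])
    have "r * ((z /\<^sub>R norm z) \<bullet> (u - z)
        - (angle_doubling z /\<^sub>R norm z) \<bullet> (angle_doubling u - angle_doubling z))
        = u \<bullet> z - angle_doubling u \<bullet> angle_doubling z"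
      using r by (simp add: r_def[symmetric] right_diff_distrib inner_diff_right zz inner_commute field_simps)
    also have "\<dots> \<le> 3/2 * n * n"
      using inner_diff_angle_doubling_le[of u z] by (simp add: n_def power2_eq_square)
    also have "\<dots> < 2 * n * (e * r / 2)"
      by (rule mult_strict_mono) (use n in auto)
    also have "\<dots> = r * (e * n)" by simp
    finally have "(z /\<^sub>R norm z) \<bullet> (u - z)
        - (angle_doubling z /\<^sub>R norm z) \<bullet> (angle_doubling u - angle_doubling z) < e * n"
      using r by (simp only: mult_less_cancel_left_pos)
    also have "\<dots> \<le> e * (norm (u - z) + norm (angle_doubling u - angle_doubling z))"
      using e by (simp add: n_def)
    finally show "(z /\<^sub>R norm z) \<bullet> (u - z)
      - (angle_doubling z /\<^sub>R norm z) \<bullet> (angle_doubling u - angle_doubling z)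
      < e * (norm (u - z) + norm (angle_doubling u - angle_doubling z))" .
  qed
qed

theorem theorem5p5:
  fixes zbar :: "real^2"
  shows "covering_constant angle_doubling zbar (angle_doubling zbar) = 1"
proof -
  define S where "S \<eta> = {ereal (norm x) | x y z.
      x \<in> mordukhovich_derivative angle_doubling z y \<and> z \<in> cball zbar \<eta> \<and>
      angle_doubling z \<in> cball (angle_doubling zbar) \<eta> \<and> norm y = 1}" for \<eta>
  \<comment> \<open>The infimum is the same for every radius, so the supremum runs over a constant
    family.\<close>
  have "Inf (S \<eta>) = 1" if \<eta>: "\<eta> > 0" for \<eta>
  proof (rule antisym)
    show "1 \<le> Inf (S \<eta>)"
      using norm_le_mordukhovich_derivative[OF angle_doubling_covering]
      by (fastforce simp: S_def intro: Inf_greatest)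
    have axis: "norm (axis 1 \<eta> :: real^2) = \<eta>"
      using \<eta> by (simp add: norm_vec2 axis_def)
    \<comment> \<open>The value 1 is attained at nonzero points. For \<open>zbar = 0\<close> a point
      of norm \<open>\<eta>\<close> serves, whose image also has norm \<open>\<eta>\<close> and so
      lies in the required ball.\<close>
    define z where "z = (if zbar = 0 then axis 1 \<eta> else zbar)"
    have z: "z \<noteq> 0" "z \<in> cball zbar \<eta>" "angle_doubling z \<in> cball (angle_doubling zbar) \<eta>"
      using \<eta> axis by (auto simp: z_def axis_eq_0_iff)
    have "ereal (norm (z /\<^sub>R norm z)) \<in> S \<eta>"
      unfolding S_def using z sgn_mem_mordukhovich_derivative_angle_doubling[OF z(1)]
      by (intro CollectI exI[of _ "z /\<^sub>R norm z"] exI[of _ "angle_doubling z /\<^sub>R norm z"] exI[of _ z])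
        auto
    then have "1 \<in> S \<eta>" using z(1) by (simp add: one_ereal_def)
    then show "Inf (S \<eta>) \<le> 1" by (rule Inf_lower)
  qed
  then have "(SUP \<eta>\<in>{0::real<..}. Inf (S \<eta>)) = (SUP \<eta>\<in>{0::real<..}. 1)"
    by (intro SUP_cong) auto
  also have "\<dots> = 1" by (simp add: SUP_constant)
  finally show ?thesis by (simp add: covering_constant_def S_def)
qed

end
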